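(* Let $a>0$, $\Omega>0$. If $\mathbf x\in\mathcal C^2((\alpha,\omega),\mathbb R^3)$ is a solution of $$\mathbf x\times\ddot{\mathbf x}-\Omega e_3\times\mathbf x+a\,\dot{\mathbf x}=0$$ with $\|\mathbf x\|\equiv R>0$ and conserved quantities $C,E$, then $u=x_3$ satisfies the ODE $$\dot u^2=a_3u^3-a_2u^2+a_1u+a_0\ \text{ on }(\alpha,\omega),\qquad -R\le u\le R,$$ where $$a_0:=\frac{2ER^2-aC^2+2\Omega CR^2}{aR^2},\quad a_1:=\frac{2aC-2\Omega R^2}{R^2},\quad a_2:=\frac{2E+a^3+2\Omega C}{aR^2},\quad a_3:=\frac{2\Omega}{R^2}.$$
   Context: $(\alpha,\omega)\subset\mathbb R$ is an open interval with variable $\xi$, dots denote $d/d\xi$, $e_3=(0,0,1)$. For any solution the quantities $C=x_1\dot x_2-x_2\dot x_1+ax_3$ and $E=\frac a2(\dot x_1^2+\dot x_2^2+\dot x_3^2)+\Omega(x_2\dot x_1-x_1\dot x_2)$, as well as the Euclidean norm $\|\mathbf x\|$, are constant in $\xi$. *)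

theory Defs
  imports "HOL-Analysis.Analysis"
begin

text \<open>On an open set the library's \<open>C1_differentiable_on\<close> is the usual class of continuously
  differentiable curves; it is applied here to the curve and to its velocity.\<close>

definition C2_differentiable_on :: "(real \<Rightarrow> 'a::real_normed_vector) \<Rightarrow> real set \<Rightarrow> bool"
    (infix \<open>C2'_differentiable'_on\<close> 50) where
  "x C2_differentiable_on S \<longleftrightarrow>
     x C1_differentiable_on S \<and> (\<lambda>\<xi>. vector_derivative x (at \<xi>)) C1_differentiable_on S"

definition vel :: "(real \<Rightarrow> real^3) \<Rightarrow> real \<Rightarrow> real^3" where
  "vel x \<xi> = vector_derivative x (at \<xi>)"

definition acc :: "(real \<Rightarrow> real^3) \<Rightarrow> real \<Rightarrow> real^3" where
  "acc x \<xi> = vector_derivative (vel x) (at \<xi>)"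

definition e3 :: "real^3" where
  "e3 = vector [0, 0, 1]"

text \<open>The interval \<open>einterval \<alpha> \<omega>\<close> is the set of reals strictly between the extended reals
  \<open>\<alpha>\<close> and \<open>\<omega>\<close>, so that unbounded intervals are included.\<close>

definition is_solution :: "real \<Rightarrow> real \<Rightarrow> ereal \<Rightarrow> ereal \<Rightarrow> (real \<Rightarrow> real^3) \<Rightarrow> bool" where
  "is_solution a \<Omega> \<alpha> \<omega> x \<longleftrightarrow>
     x C2_differentiable_on einterval \<alpha> \<omega> \<and>
     (\<forall>\<xi>\<in>einterval \<alpha> \<omega>.
        cross3 (x \<xi>) (acc x \<xi>) - \<Omega> *\<^sub>R cross3 e3 (x \<xi>) + a *\<^sub>R vel x \<xi> = 0)"

definition C_quantity :: "real \<Rightarrow> (real \<Rightarrow> real^3) \<Rightarrow> real \<Rightarrow> real" where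
  "C_quantity a x \<xi> = x \<xi> $ 1 * vel x \<xi> $ 2 - x \<xi> $ 2 * vel x \<xi> $ 1 + a * x \<xi> $ 3"

definition E_quantity :: "real \<Rightarrow> real \<Rightarrow> (real \<Rightarrow> real^3) \<Rightarrow> real \<Rightarrow> real" where
  "E_quantity a \<Omega> x \<xi> =
     a / 2 * ((vel x \<xi> $ 1)\<^sup>2 + (vel x \<xi> $ 2)\<^sup>2 + (vel x \<xi> $ 3)\<^sup>2)
     + \<Omega> * (x \<xi> $ 2 * vel x \<xi> $ 1 - x \<xi> $ 1 * vel x \<xi> $ 2)"

end

theory Submission
  imports Defs
begin

text \<open>The third component of the equation is the conservation of \<open>C\<close>, and its inner product with
  the acceleration is the conservation of \<open>E\<close>; its inner product with \<open>x\<close> shows that \<open>x\<close> is orthogonal to its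
  velocity \<open>v\<close>. Put \<open>L = x\<^sub>1 v\<^sub>2 - x\<^sub>2 v\<^sub>1\<close>. By the planar Lagrange identity
  \<open>(x\<^sub>1\<^sup>2 + x\<^sub>2\<^sup>2)(v\<^sub>1\<^sup>2 + v\<^sub>2\<^sup>2) = L\<^sup>2 + (x\<^sub>1 v\<^sub>1 + x\<^sub>2 v\<^sub>2)\<^sup>2\<close> and orthogonality,
  \<open>R\<^sup>2 v\<^sub>3\<^sup>2 = (R\<^sup>2 - x\<^sub>3\<^sup>2) \<bar>v\<bar>\<^sup>2 - L\<^sup>2\<close>. Substituting \<open>L = C - a x\<^sub>3\<close> and
  \<open>\<bar>v\<bar>\<^sup>2 = 2 (E + \<Omega> L) / a\<close> gives the cubic.\<close>

lemma is_interval_einterval: "is_interval (einterval \<alpha> \<omega>)"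
  unfolding is_interval_1 einterval_def
  by (auto intro: less_le_trans[of \<alpha> "ereal _" "ereal _"] le_less_trans[of "ereal _" "ereal _" \<omega>])

text \<open>This turns a vanishing derivative into a conservation law. Convexity of the interval is
  enough, so infinite endpoints need no special care.\<close>

lemma has_real_derivative_zero_einterval:
  fixes f :: "real \<Rightarrow> real"
  assumes "\<And>t. t \<in> einterval \<alpha> \<omega> \<Longrightarrow> (f has_real_derivative 0) (at t)"
    and "s \<in> einterval \<alpha> \<omega>" and "t \<in> einterval \<alpha> \<omega>"
  shows "f s = f t"
proof -
  have "convex (einterval \<alpha> \<omega>)"
    by (simp add: is_interval_convex is_interval_einterval)
  then obtain c where "\<And>t. t \<in> einterval \<alpha> \<omega> \<Longrightarrow> f t = c"
    by (metis (no_types, lifting) has_field_derivative_zero_constant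
        has_field_derivative_at_within assms(1))
  with assms(2,3) show ?thesis by simp
qed

lemma has_real_derivative_vec_nth:
  assumes "(f has_vector_derivative f') (at t)"
  shows "((\<lambda>s. f s $ i) has_real_derivative f' $ i) (at t)"
  using bounded_linear.has_vector_derivative[OF bounded_linear_vec_nth assms]
  by (simp add: has_real_derivative_iff_has_vector_derivative)

context
  fixes a \<Omega> :: real and \<alpha> \<omega> :: ereal and x :: "real \<Rightarrow> real^3"
  assumes sol: "is_solution a \<Omega> \<alpha> \<omega> x"
begin

lemma solution_components:
  assumes "t \<in> einterval \<alpha> \<omega>"
  shows "x t $ 2 * acc x t $ 3 - x t $ 3 * acc x t $ 2 + \<Omega> * x t $ 2 + a * vel x t $ 1 = 0"
    and "x t $ 3 * acc x t $ 1 - x t $ 1 * acc x t $ 3 - \<Omega> * x t $ 1 + a * vel x t $ 2 = 0"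
    and "x t $ 1 * acc x t $ 2 - x t $ 2 * acc x t $ 1 + a * vel x t $ 3 = 0"
  using sol assms
  by (auto simp: is_solution_def cross3_def e3_def vec_eq_iff forall_3 vector_3)

lemma solution_has_derivative:
  assumes "t \<in> einterval \<alpha> \<omega>"
  shows "((\<lambda>s. x s $ i) has_real_derivative vel x t $ i) (at t)"
    and "((\<lambda>s. vel x s $ i) has_real_derivative acc x t $ i) (at t)"
proof -
  have "x differentiable at t" "vel x differentiable at t"
    using sol assms
    by (auto simp: is_solution_def C2_differentiable_on_def C1_differentiable_on_eq
        vel_def[abs_def])
  then have "(x has_vector_derivative vel x t) (at t)"
    "(vel x has_vector_derivative acc x t) (at t)"
    by (simp_all add: vector_derivative_works[symmetric] acc_def vel_def)
  then show "((\<lambda>s. x s $ i) has_real_derivative vel x t $ i) (at t)"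
    "((\<lambda>s. vel x s $ i) has_real_derivative acc x t $ i) (at t)"
    by (auto intro: has_real_derivative_vec_nth)
qed

text \<open>Under differentiation the products of two velocities cancel, and what is left is the
  third component of the equation.\<close>

lemma C_quantity_conserved:
  assumes "s \<in> einterval \<alpha> \<omega>" "t \<in> einterval \<alpha> \<omega>"
  shows "C_quantity a x s = C_quantity a x t"
proof (rule has_real_derivative_zero_einterval[OF _ assms])
  fix r assume r: "r \<in> einterval \<alpha> \<omega>"
  show "(C_quantity a x has_real_derivative 0) (at r)"
    unfolding C_quantity_def[abs_def]
    using solution_components(3)[OF r]
    by (auto intro!: derivative_eq_intros solution_has_derivative[OF r] simp: algebra_simps)
qed

lemma E_quantity_conserved:
  assumes "s \<in> einterval \<alpha> \<omega>" "t \<in> einterval \<alpha> \<omega>"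
  shows "E_quantity a \<Omega> x s = E_quantity a \<Omega> x t"
proof (rule has_real_derivative_zero_einterval[OF _ assms])
  fix r assume r: "r \<in> einterval \<alpha> \<omega>"
  \<comment> \<open>\<open>D\<close> is the derivative of \<open>E_quantity\<close> after the mixed
    velocity products in the \<Omega> term have cancelled.\<close>
  define D where "D = a * (vel x r $ 1 * acc x r $ 1 + vel x r $ 2 * acc x r $ 2
      + vel x r $ 3 * acc x r $ 3) + \<Omega> * (x r $ 2 * acc x r $ 1 - x r $ 1 * acc x r $ 2)"
  have "(E_quantity a \<Omega> x has_real_derivative D) (at r)"
    unfolding E_quantity_def[abs_def] D_def
    by (auto intro!: derivative_eq_intros solution_has_derivative[OF r] simp: algebra_simps)
  \<comment> \<open>Multiply the three components by those of \<open>acc x r\<close> and add: the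
    triple product with a repeated acceleration vanishes, and the rest is exactly
    \<open>D\<close>.\<close>
  moreover have "D = 0"
    using solution_components[OF r] unfolding D_def by algebra
  ultimately show "(E_quantity a \<Omega> x has_real_derivative 0) (at r)"
    by simp
qed

text \<open>Both cross products in the equation are orthogonal to \<open>x t\<close>, so pairing
  with \<open>x t\<close> leaves only \<open>a\<close> times this inner product.\<close>

lemma solution_orthogonal_vel:
  assumes "t \<in> einterval \<alpha> \<omega>" and "a \<noteq> 0"
  shows "x t $ 1 * vel x t $ 1 + x t $ 2 * vel x t $ 2 + x t $ 3 * vel x t $ 3 = 0"
  using solution_components[OF assms(1)] assms(2) by algebra

end

theorem proposition2p3:
  fixes a \<Omega> R C E a0 a1 a2 a3 \<xi>0 :: real
    and \<alpha> \<omega> :: ereal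
    and x :: "real \<Rightarrow> real^3"
    and u :: "real \<Rightarrow> real"
  assumes "a > 0" and "\<Omega> > 0" and "R > 0"
    and "is_solution a \<Omega> \<alpha> \<omega> x"
    and "\<forall>\<xi>\<in>einterval \<alpha> \<omega>. norm (x \<xi>) = R"
    and "\<xi>0 \<in> einterval \<alpha> \<omega>"
    and "C = C_quantity a x \<xi>0"
    and "E = E_quantity a \<Omega> x \<xi>0"
    and "u = (\<lambda>\<xi>. x \<xi> $ 3)"
    and "a0 = (2 * E * R\<^sup>2 - a * C\<^sup>2 + 2 * \<Omega> * C * R\<^sup>2) / (a * R\<^sup>2)"
    and "a1 = (2 * a * C - 2 * \<Omega> * R\<^sup>2) / R\<^sup>2"
    and "a2 = (2 * E + a ^ 3 + 2 * \<Omega> * C) / (a * R\<^sup>2)"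
    and "a3 = 2 * \<Omega> / R\<^sup>2"
  shows "\<forall>\<xi>\<in>einterval \<alpha> \<omega>.
           u differentiable (at \<xi>) \<and>
           (deriv u \<xi>)\<^sup>2 = a3 * (u \<xi>) ^ 3 - a2 * (u \<xi>)\<^sup>2 + a1 * u \<xi> + a0 \<and>
           - R \<le> u \<xi> \<and> u \<xi> \<le> R"
proof
  fix \<xi> assume \<xi>: "\<xi> \<in> einterval \<alpha> \<omega>"
  note sol = assms(4) and u = assms(9)
  let ?X = "x \<xi>" and ?V = "vel x \<xi>"
  have du: "(u has_real_derivative ?V $ 3) (at \<xi>)"
    unfolding u by (rule solution_has_derivative(1)[OF sol \<xi>])
  have X: "norm ?X = R"
    using assms(5) \<xi> by blast
  then have R2: "(?X $ 1)\<^sup>2 + (?X $ 2)\<^sup>2 + (?X $ 3)\<^sup>2 = R\<^sup>2"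
    by (auto simp: norm_eq_sqrt_inner inner_vec_def sum_3 power2_eq_square)
  have orth: "?X $ 1 * ?V $ 1 + ?X $ 2 * ?V $ 2 + ?X $ 3 * ?V $ 3 = 0"
    using solution_orthogonal_vel[OF sol \<xi>] \<open>a > 0\<close> by simp
  \<comment> \<open>Conservation moves the constants, given at \<xi>0, to the current point.\<close>
  have C: "C = ?X $ 1 * ?V $ 2 - ?X $ 2 * ?V $ 1 + a * ?X $ 3"
    using C_quantity_conserved[OF sol assms(6) \<xi>] assms(7) by (simp add: C_quantity_def)
  have E: "2 * E = a * ((?V $ 1)\<^sup>2 + (?V $ 2)\<^sup>2 + (?V $ 3)\<^sup>2)
      + 2 * \<Omega> * (?X $ 2 * ?V $ 1 - ?X $ 1 * ?V $ 2)"
    using E_quantity_conserved[OF sol assms(6) \<xi>] assms(8) by (simp add: E_quantity_def)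
  \<comment> \<open>This is the ODE with denominators cleared. It is \<open>a\<close> times the
    formula for \<open>R\<^sup>2 * (?V $ 3)\<^sup>2\<close> and a purely polynomial consequence, so
    points on the third axis need no separate case.\<close>
  have "a * R\<^sup>2 * (?V $ 3)\<^sup>2 =
      2 * \<Omega> * a * ?X $ 3 ^ 3 - (2 * E + a ^ 3 + 2 * \<Omega> * C) * (?X $ 3)\<^sup>2
      + (2 * a * C - 2 * \<Omega> * R\<^sup>2) * a * ?X $ 3
      + (2 * E * R\<^sup>2 - a * C\<^sup>2 + 2 * \<Omega> * C * R\<^sup>2)"
    using R2 orth C E by algebra
  moreover have "a * R\<^sup>2 * a0 = 2 * E * R\<^sup>2 - a * C\<^sup>2 + 2 * \<Omega> * C * R\<^sup>2"
    "R\<^sup>2 * a1 = 2 * a * C - 2 * \<Omega> * R\<^sup>2"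
    "a * R\<^sup>2 * a2 = 2 * E + a ^ 3 + 2 * \<Omega> * C"
    "R\<^sup>2 * a3 = 2 * \<Omega>"
    using \<open>a > 0\<close> \<open>R > 0\<close> by (simp_all add: assms(10-13))
  \<comment> \<open>This allows the common factor to be cancelled.\<close>
  moreover have "a * R\<^sup>2 \<noteq> 0"
    using \<open>a > 0\<close> \<open>R > 0\<close> by simp
  ultimately have "(?V $ 3)\<^sup>2 = a3 * u \<xi> ^ 3 - a2 * (u \<xi>)\<^sup>2 + a1 * u \<xi> + a0"
    unfolding u by algebra
  moreover have "\<bar>u \<xi>\<bar> \<le> R"
    unfolding u using component_le_norm_cart[of ?X 3] X by simp
  ultimately show "u differentiable (at \<xi>) \<and>
      (deriv u \<xi>)\<^sup>2 = a3 * (u \<xi>) ^ 3 - a2 * (u \<xi>)\<^sup>2 + a1 * u \<xi> + a0 \<and>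
      - R \<le> u \<xi> \<and> u \<xi> \<le> R"
    using du DERIV_imp_deriv[OF du] real_differentiable_def by auto
qed

end
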